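(* There is no algorithm that, given any constructive linear programming problem (CLPP) whose set of allowable plans is nonempty and bounded, together with an allowable plan for it, always decides whether the given allowable plan is optimal or not.
   Context: "Algorithm" means Turing machine (partial recursive function); algorithms are encoded by natural numbers, and an algorithm applied to other algorithms receives their codes. To decide a property means to terminate on every input of the given kind and output $1$ or $0$ according to whether the property holds or not. A constructive real number (CRN) is a pair of algorithms $(F,R)$, where $F$ transforms every natural number into a rational number, $R$ transforms every positive rational number into a natural number, and for every rational $\varepsilon>0$ and all $m,n>R(\varepsilon)$ one has $|F(m)-F(n)|<\varepsilon$. If $x=(F,R)$, write $x(n)=F(n)$. For CRNs $x,y$: $x=y$ means that for every rational $\varepsilon>0$ one can algorithmically produce a natural $M$ such that $|x(m)-y(n)|<\varepsilon$ for all $m,n>M$; $x<y$ means that one can produce a rational $\varepsilon>0$ and a natural $M$ such that $y(m)>x(n)+\varepsilon$ for all $m,n>M$; $x\le y$ means that for every rational $\varepsilon>0$ one can algorithmically produce a natural $M$ such that $y(m)>x(n)-\varepsilon$ for all $m,n>M$. Arithmetic operations on CRNs are the natural ones. An algorithm receiving a CRN as input receives the codes of the pair $(F,R)$; algorithms on CRNs are not required to give equal results for equal CRNs. A constructive linear programming problem (CLPP) is a problem of maximizing or minimizing a linear function (the cost function) of finitely many variables subject to finitely many linear equations and nonstrict linear inequalities, all of whose coefficients and constants are CRNs; it is given by (the codes of) these CRNs. A plan is a tuple of CRNs, one for each variable. A plan is allowable if it satisfies all the constraints. An allowable plan is optimal if the cost function attains at it its maximum (respectively minimum) over all allowable plans.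 The set of allowable plans is nonempty if it is impossible that no allowable plan exists, and it is bounded if there is a rational number bounding the absolute values of all coordinates of all allowable plans. *)

theory Defs
  imports Complex_Main "HOL-Library.Nat_Bijection"
begin

section \<open>Algorithms\<close>

text \<open>
  Kleene's schemes for partial recursive functions. The initial functions are defined for
  every number of arguments for which they make sense; a term applied to an argument list that
  does not fit is undefined.
\<close>

datatype recf =
    Zero
  | Succ
  | Proj nat
  | Comp recf "recf list"
  | PrimRec recf recf
  | Mu recf

fun run :: "recf \<Rightarrow> nat list \<Rightarrow> nat option" where
  "run Zero xs = Some 0"
| "run Succ xs = (case xs of [x] \<Rightarrow> Some (Suc x) | _ \<Rightarrow> None)"
| "run (Proj i) xs = (if i < length xs then Some (xs ! i) else None)"
| "run (Comp f gs) xs =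
    (if \<exists>g\<in>set gs. run g xs = None then None
     else run f (map (\<lambda>g. the (run g xs)) gs))"
| "run (PrimRec f g) xs =
    (case xs of
       [] \<Rightarrow> None
     | n # ys \<Rightarrow>
         rec_nat (run f ys)
           (\<lambda>k r. case r of None \<Rightarrow> None | Some v \<Rightarrow> run g (k # v # ys)) n)"
| "run (Mu f) xs =
    (if \<exists>n. run f (n # xs) = Some 0 \<and> (\<forall>k<n. run f (k # xs) \<noteq> None)
     then Some (LEAST n. run f (n # xs) = Some 0)
     else None)"

fun recf_code :: "recf \<Rightarrow> nat" where
  "recf_code Zero = prod_encode (0, 0)"
| "recf_code Succ = prod_encode (1, 0)"
| "recf_code (Proj i) = prod_encode (2, i)"
| "recf_code (Comp f gs) =
    prod_encode (3, prod_encode (recf_code f, list_encode (map recf_code gs)))"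
| "recf_code (PrimRec f g) = prod_encode (4, prod_encode (recf_code f, recf_code g))"
| "recf_code (Mu f) = prod_encode (5, recf_code f)"

lemma recf_code_inject: "recf_code f = recf_code g \<Longrightarrow> f = g"
proof (induction f arbitrary: g)
  case (Comp f fs)
  then obtain h hs where g: "g = Comp h hs"
    by (cases g) (auto simp: prod_encode_eq)
  have "map recf_code fs = map recf_code hs"
    using Comp.prems g by (simp add: prod_encode_eq list_encode_eq)
  then have "fs = hs"
    using Comp.IH(2)
  proof (induction fs arbitrary: hs)
    case (Cons a fs)
    then show ?case by (cases hs) auto
  qed simp
  then show ?case
    using Comp.prems Comp.IH(1) g by (simp add: prod_encode_eq)
next
  case Zero then show ?case by (cases g) (auto simp: prod_encode_eq)
next
  case Succ then show ?case by (cases g) (auto simp: prod_encode_eq)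
next
  case Proj then show ?case by (cases g) (auto simp: prod_encode_eq)
next
  case PrimRec from PrimRec.prems PrimRec.IH show ?case by (cases g) (auto simp: prod_encode_eq)
next
  case Mu from Mu.prems Mu.IH show ?case by (cases g) (auto simp: prod_encode_eq)
qed

text \<open>Rationals are coded by numerator and positive denominator in lowest terms.\<close>

definition rat_code :: "rat \<Rightarrow> nat" where
  "rat_code q = (case quotient_of q of (a, b) \<Rightarrow> prod_encode (int_encode a, nat b))"

lemma rat_code_inject: "rat_code p = rat_code q \<Longrightarrow> p = q"
proof -
  assume eq: "rat_code p = rat_code q"
  obtain a b c d where q: "quotient_of p = (a, b)" "quotient_of q = (c, d)"
    by fastforce
  then have "b > 0" "d > 0"
    by (auto intro: quotient_of_denom_pos)
  with eq q have "a = c \<and> b = d"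
    by (auto simp: rat_code_def prod_encode_eq int_encode_eq)
  with q show ?thesis
    by (auto dest: quotient_of_div)
qed


section \<open>Constructive real numbers\<close>

type_synonym crn = "recf \<times> recf"

text \<open>For each \<open>n\<close> there is at most one such rational, since \<open>rat_code\<close> is injective.\<close>

definition crn_val :: "crn \<Rightarrow> nat \<Rightarrow> rat" where
  "crn_val x n = (THE q. run (fst x) [n] = Some (rat_code q))"

definition is_crn :: "crn \<Rightarrow> bool" where
  "is_crn x \<longleftrightarrow>
    (\<forall>n. \<exists>q. run (fst x) [n] = Some (rat_code q)) \<and>
    (\<forall>\<epsilon>>0. \<exists>N. run (snd x) [rat_code \<epsilon>] = Some N \<and>
       (\<forall>m n. m > N \<longrightarrow> n > N \<longrightarrow> \<bar>crn_val x m - crn_val x n\<bar> < \<epsilon>))"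

definition crn_code :: "crn \<Rightarrow> nat" where
  "crn_code x = prod_encode (recf_code (fst x), recf_code (snd x))"

text \<open>
  The order and equality of constructive reals depend only on the sequences \<open>crn_val x\<close>, and
  sums, products and absolute values are formed termwise on these sequences; therefore the
  relations are defined on sequences of rationals. The algorithm \<open>A\<close> is the one producing \<open>M\<close>
  from \<open>\<epsilon>\<close>.
\<close>

definition creal_eq :: "(nat \<Rightarrow> rat) \<Rightarrow> (nat \<Rightarrow> rat) \<Rightarrow> bool" where
  "creal_eq x y \<longleftrightarrow>
    (\<exists>A. \<forall>\<epsilon>>0. \<exists>M. run A [rat_code \<epsilon>] = Some M \<and>
       (\<forall>m n. m > M \<longrightarrow> n > M \<longrightarrow> \<bar>x m - y n\<bar> < \<epsilon>))"

definition creal_le :: "(nat \<Rightarrow> rat) \<Rightarrow> (nat \<Rightarrow> rat) \<Rightarrow> bool" where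
  "creal_le x y \<longleftrightarrow>
    (\<exists>A. \<forall>\<epsilon>>0. \<exists>M. run A [rat_code \<epsilon>] = Some M \<and>
       (\<forall>m n. m > M \<longrightarrow> n > M \<longrightarrow> y m > x n - \<epsilon>))"


section \<open>Constructive linear programming problems\<close>

datatype goal = Maximize | Minimize

datatype relation = Equal | AtMost | AtLeast

text \<open>A constraint consists of the coefficients, the relation and the right-hand side.\<close>

type_synonym lin_constraint = "crn list \<times> relation \<times> crn"

text \<open>The number of variables is the number of coefficients of the cost function.\<close>

datatype clpp = CLPP (goal: goal) (cost: "crn list") (constraints: "lin_constraint list")

definition is_clpp :: "clpp \<Rightarrow> bool" where
  "is_clpp P \<longleftrightarrow>
    (\<forall>c\<in>set (cost P). is_crn c) \<and>
    (\<forall>(as, r, b)\<in>set (constraints P).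
       length as = length (cost P) \<and> (\<forall>a\<in>set as. is_crn a) \<and> is_crn b)"

definition lin_val :: "crn list \<Rightarrow> crn list \<Rightarrow> nat \<Rightarrow> rat" where
  "lin_val as p n = (\<Sum>i<length as. crn_val (as ! i) n * crn_val (p ! i) n)"

definition is_plan :: "clpp \<Rightarrow> crn list \<Rightarrow> bool" where
  "is_plan P p \<longleftrightarrow> length p = length (cost P) \<and> (\<forall>x\<in>set p. is_crn x)"

fun satisfies :: "crn list \<Rightarrow> lin_constraint \<Rightarrow> bool" where
  "satisfies p (as, Equal, b) = creal_eq (lin_val as p) (crn_val b)"
| "satisfies p (as, AtMost, b) = creal_le (lin_val as p) (crn_val b)"
| "satisfies p (as, AtLeast, b) = creal_le (crn_val b) (lin_val as p)"

definition allowable :: "clpp \<Rightarrow> crn list \<Rightarrow> bool" where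
  "allowable P p \<longleftrightarrow> is_plan P p \<and> (\<forall>c\<in>set (constraints P). satisfies p c)"

definition optimal :: "clpp \<Rightarrow> crn list \<Rightarrow> bool" where
  "optimal P p \<longleftrightarrow>
    allowable P p \<and>
    (\<forall>q. allowable P q \<longrightarrow>
       (case goal P of
          Maximize \<Rightarrow> creal_le (lin_val (cost P) q) (lin_val (cost P) p)
        | Minimize \<Rightarrow> creal_le (lin_val (cost P) p) (lin_val (cost P) q)))"

definition plans_nonempty :: "clpp \<Rightarrow> bool" where
  "plans_nonempty P \<longleftrightarrow> \<not> (\<nexists>p. allowable P p)"

definition plans_bounded :: "clpp \<Rightarrow> bool" where
  "plans_bounded P \<longleftrightarrow>
    (\<exists>B::rat. \<forall>p. allowable P p \<longrightarrow>
       (\<forall>x\<in>set p. creal_le (\<lambda>n. \<bar>crn_val x n\<bar>) (\<lambda>_. B)))"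

fun goal_code :: "goal \<Rightarrow> nat" where
  "goal_code Maximize = 0"
| "goal_code Minimize = 1"

fun relation_code :: "relation \<Rightarrow> nat" where
  "relation_code Equal = 0"
| "relation_code AtMost = 1"
| "relation_code AtLeast = 2"

definition crns_code :: "crn list \<Rightarrow> nat" where
  "crns_code xs = list_encode (map crn_code xs)"

fun constraint_code :: "lin_constraint \<Rightarrow> nat" where
  "constraint_code (as, r, b) =
    prod_encode (crns_code as, prod_encode (relation_code r, crn_code b))"

definition clpp_code :: "clpp \<Rightarrow> nat" where
  "clpp_code P =
    prod_encode (goal_code (goal P),
      prod_encode (crns_code (cost P), list_encode (map constraint_code (constraints P))))"

definition decides_optimality :: "recf \<Rightarrow> bool" where
  "decides_optimality D \<longleftrightarrow>
    (\<forall>P p. is_clpp P \<longrightarrow> plans_nonempty P \<longrightarrow> plans_bounded P \<longrightarrow> allowable P p \<longrightarrow>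
       run D [prod_encode (clpp_code P, crns_code p)] = Some (if optimal P p then 1 else 0))"

end

theory Submission
  imports Defs
begin

text \<open>
  For a constructive real \<open>a\<close> that is never negative, maximize \<open>a * x\<close> over \<open>0 \<le> x \<le> 1\<close>: the
  plan \<open>0\<close> is optimal iff \<open>a = 0\<close>. Given a decider \<open>D\<close>, diagonalization yields an \<open>a\<close> that runs
  \<open>D\<close> on the code of its own problem: \<open>a n = 1 / (h n + 1)\<close>, where \<open>h\<close> counts steps until \<open>D\<close>
  is seen to answer ``optimal'' and then stops. If \<open>D\<close> answers ``optimal'', then \<open>a\<close> is eventually
  a positive constant, otherwise \<open>a n = 1 / (n + 1)\<close> represents \<open>0\<close>; so \<open>D\<close> is wrong either way.
  Since \<open>D\<close> is fixed, its step-bounded simulation is built by structural recursion and no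
  universal machine is required.
\<close>

section \<open>Total computable functions\<close>

text \<open>Only lists of length \<open>k\<close> count, so \<open>hd\<close>, \<open>tl\<close> and
  \<open>!\<close> may occur in bodies without regard to their values on other lists.\<close>

definition computable :: "nat \<Rightarrow> (nat list \<Rightarrow> nat) \<Rightarrow> bool" where
  "computable k \<phi> \<longleftrightarrow> (\<exists>f. \<forall>xs. length xs = k \<longrightarrow> run f xs = Some (\<phi> xs))"

lemma computableI: "(\<And>xs. length xs = k \<Longrightarrow> run f xs = Some (\<phi> xs)) \<Longrightarrow> computable k \<phi>"
  unfolding computable_def by blast

lemma computable_cong:
  "computable k \<phi> \<Longrightarrow> (\<And>xs. length xs = k \<Longrightarrow> \<phi> xs = \<psi> xs) \<Longrightarrow> computable k \<psi>"
  unfolding computable_def by metis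

fun numeral_recf :: "nat \<Rightarrow> recf" where
  "numeral_recf 0 = Zero"
| "numeral_recf (Suc n) = Comp Succ [numeral_recf n]"

lemma run_numeral_recf [simp]: "run (numeral_recf n) xs = Some n"
  by (induction n) auto

section \<open>Closure properties of computable functions\<close>

lemma computable_const: "computable k (\<lambda>xs. c)"
  by (rule computableI[where f = "numeral_recf c"]) simp

lemma computable_nth: "i < k \<Longrightarrow> computable k (\<lambda>xs. xs ! i)"
  by (rule computableI[where f = "Proj i"]) simp

text \<open>Composition in the list form of \<open>Comp\<close>. With projections among the
  \<open>gs\<close> it also permutes, drops and inserts arguments.\<close>

lemma computable_map:
  assumes "computable (length gs) \<phi>" and "\<And>g. g \<in> set gs \<Longrightarrow> computable k g"
  shows "computable k (\<lambda>xs. \<phi> (map (\<lambda>g. g xs) gs))"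
proof -
  obtain f where f: "\<And>ys. length ys = length gs \<Longrightarrow> run f ys = Some (\<phi> ys)"
    using assms(1) unfolding computable_def by blast
  obtain G where G: "\<And>g xs. g \<in> set gs \<Longrightarrow> length xs = k \<Longrightarrow> run (G g) xs = Some (g xs)"
    using assms(2) unfolding computable_def by metis
  show ?thesis
  proof (rule computableI[where f = "Comp f (map G gs)"])
    fix xs :: "nat list" assume "length xs = k"
    then show "run (Comp f (map G gs)) xs = Some (\<phi> (map (\<lambda>g. g xs) gs))"
      using f G by (auto simp: comp_def cong: map_cong)
  qed
qed

lemma computable_Suc: "computable k f \<Longrightarrow> computable k (\<lambda>xs. Suc (f xs))"
proof -
  assume f: "computable k f"
  have "computable 1 (\<lambda>ys. Suc (ys ! 0))"
    by (rule computableI[where f = Succ]) (auto simp: length_Suc_conv)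
  then show ?thesis
    using computable_map[of "[f]" "\<lambda>ys. Suc (ys ! 0)"] f by simp
qed

lemma computable_rec_nat:
  assumes "computable k f" "computable k n"
    and g: "computable (Suc (Suc k)) (\<lambda>ys. g (tl (tl ys)) (ys ! 0) (ys ! 1))"
  shows "computable k (\<lambda>xs. rec_nat (f xs) (g xs) (n xs))"
proof -
  obtain F where F: "\<And>xs. length xs = k \<Longrightarrow> run F xs = Some (f xs)"
    using assms(1) unfolding computable_def by blast
  obtain G where "\<forall>ys. length ys = Suc (Suc k) \<longrightarrow> run G ys = Some (g (tl (tl ys)) (ys ! 0) (ys ! 1))"
    using g unfolding computable_def by blast
  then have G: "run G (j # r # xs) = Some (g xs j r)" if "length xs = k" for j r xs
    using that by (metis One_nat_def length_Cons list.sel(3) nth_Cons_0 nth_Cons_Suc)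
  have "run (PrimRec F G) (m # xs) = Some (rec_nat (f xs) (g xs) m)" if "length xs = k" for m xs
    by (induction m) (use F G that in auto)
  then have "computable (Suc k) (\<lambda>ys. rec_nat (f (tl ys)) (g (tl ys)) (hd ys))"
    by (intro computableI[where f = "PrimRec F G"]) (auto simp: length_Suc_conv)
  \<comment> \<open>\<open>PrimRec\<close> recurses on its first argument, so the computed bound
    \<open>n\<close> is placed in front of the projections that restore the parameters.\<close>
  then have "computable k (\<lambda>xs. (\<lambda>ys. rec_nat (f (tl ys)) (g (tl ys)) (hd ys))
      (map (\<lambda>g. g xs) (n # map (\<lambda>i xs. xs ! i) [0..<k])))"
    using assms(2) by (intro computable_map) (auto intro: computable_nth)
  then show ?thesis
    by (rule computable_cong) (auto simp: comp_def map_nth)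
qed

lemma computable_drop2: "computable k f \<Longrightarrow> computable (Suc (Suc k)) (\<lambda>ys. f (tl (tl ys)))"
proof -
  assume "computable k f"
  then have "computable (Suc (Suc k))
      (\<lambda>ys. f (map (\<lambda>g. g ys) (map (\<lambda>i ys. ys ! (Suc (Suc i))) [0..<k])))"
    by (intro computable_map) (auto intro: computable_nth)
  then show ?thesis
  proof (rule computable_cong)
    fix ys :: "nat list" assume "length ys = Suc (Suc k)"
    then obtain a b xs where "ys = a # b # xs" "length xs = k"
      by (auto simp: length_Suc_conv)
    then show "f (map (\<lambda>g. g ys) (map (\<lambda>i ys. ys ! (Suc (Suc i))) [0..<k])) = f (tl (tl ys))"
      by (auto simp: comp_def map_nth)
  qed
qed

lemma computable_if:
  assumes "computable k c" "computable k a" "computable k b"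
  shows "computable k (\<lambda>xs. if c xs = 0 then a xs else b xs)"
proof -
  \<comment> \<open>A recursion whose step ignores both the counter and the previous value is a case
    distinction.\<close>
  have "computable k (\<lambda>xs. rec_nat (a xs) (\<lambda>_ _. b xs) (c xs))"
    using assms by (intro computable_rec_nat computable_drop2)
  then show ?thesis
    by (rule computable_cong) (auto split: nat.split simp: neq0_conv gr0_conv_Suc)
qed

lemma computable_pred: "computable k f \<Longrightarrow> computable k (\<lambda>xs. f xs - 1)"
proof -
  assume "computable k f"
  then have "computable k (\<lambda>xs. rec_nat 0 (\<lambda>j _. j) (f xs))"
    by (intro computable_rec_nat computable_const computable_nth) auto
  moreover have "rec_nat 0 (\<lambda>j _. j) n = n - 1" for n :: nat
    by (cases n) auto
  ultimately show ?thesis by simp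
qed

lemma computable_add:
  assumes "computable k f" "computable k g"
  shows "computable k (\<lambda>xs. f xs + g xs)"
proof -
  have "computable k (\<lambda>xs. rec_nat (f xs) (\<lambda>_ r. Suc r) (g xs))"
    using assms by (intro computable_rec_nat computable_Suc computable_nth) auto
  moreover have "rec_nat m (\<lambda>_ r. Suc r) n = m + n" for m n :: nat
    by (induction n) auto
  ultimately show ?thesis by simp
qed

lemma computable_mult:
  assumes "computable k f" "computable k g"
  shows "computable k (\<lambda>xs. f xs * g xs)"
proof -
  have "computable k (\<lambda>xs. rec_nat 0 (\<lambda>_ r. f xs + r) (g xs))"
    using assms
    by (intro computable_rec_nat computable_add computable_drop2 computable_const computable_nth) auto
  moreover have "rec_nat 0 (\<lambda>_ r. m + r) n = m * n" for m n :: nat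
    by (induction n) auto
  ultimately show ?thesis by simp
qed

lemma computable_prod_encode:
  assumes "computable k f" "computable k g"
  shows "computable k (\<lambda>xs. prod_encode (f xs, g xs))"
proof -
  \<comment> \<open>The recursion computes the triangular number in the pairing function.\<close>
  have "computable k (\<lambda>xs. rec_nat 0 (\<lambda>j r. r + Suc j) (f xs + g xs) + f xs)"
    using assms
    by (intro computable_rec_nat computable_add computable_const computable_Suc computable_nth) auto
  moreover have "rec_nat 0 (\<lambda>j r. r + Suc j) n = triangle n" for n
    by (induction n) auto
  ultimately show ?thesis by (simp add: prod_encode_def)
qed

lemma computable_prod_list:
  "(\<And>g. g \<in> set gs \<Longrightarrow> computable k (\<phi> g)) \<Longrightarrow> computable k (\<lambda>xs. \<Prod>g\<leftarrow>gs. \<phi> g xs)"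
  by (induction gs) (auto intro: computable_const computable_mult)

text \<open>Needed for self-reference: the diagonal program must compute the code of the numeral
  that supplies its own code.\<close>

lemma computable_numeral_code:
  "computable k f \<Longrightarrow> computable k (\<lambda>xs. recf_code (numeral_recf (f xs)))"
proof -
  \<comment> \<open>Here 3 is the tag of \<open>Comp\<close>, and
    \<open>Suc (prod_encode (r, 0))\<close> is \<open>list_encode [r]\<close>.\<close>
  let ?step = "\<lambda>_ r. prod_encode (3, prod_encode (recf_code Succ, Suc (prod_encode (r, 0))))"
  assume "computable k f"
  then have "computable k (\<lambda>xs. rec_nat (recf_code Zero) ?step (f xs))"
    by (intro computable_rec_nat computable_prod_encode computable_Suc computable_const computable_nth)
      auto
  moreover have "recf_code (numeral_recf n) = rec_nat (recf_code Zero) ?step n" for n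
    by (induction n) auto
  ultimately show ?thesis by simp
qed


section \<open>Step-bounded evaluation\<close>

text \<open>
  The result \<open>0\<close> means that no value has been found within the bound, \<open>Suc v\<close> that the value is
  \<open>v\<close>; only unbounded search consumes the bound. The state of the search is \<open>0\<close> while it goes on,
  \<open>1\<close> if it is stuck and \<open>n + 2\<close> if \<open>n\<close> has been found.
\<close>

fun appr :: "recf \<Rightarrow> nat \<Rightarrow> nat list \<Rightarrow> nat" where
  "appr Zero t xs = 1"
| "appr Succ t xs = (case xs of [x] \<Rightarrow> Suc (Suc x) | _ \<Rightarrow> 0)"
| "appr (Proj i) t xs = (if i < length xs then Suc (xs ! i) else 0)"
| "appr (Comp f gs) t xs =
    (if \<exists>g\<in>set gs. appr g t xs = 0 then 0
     else appr f t (map (\<lambda>g. appr g t xs - 1) gs))"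
| "appr (PrimRec f g) t xs =
    (case xs of
       [] \<Rightarrow> 0
     | n # ys \<Rightarrow>
         rec_nat (appr f t ys) (\<lambda>k r. if r = 0 then 0 else appr g t (k # (r - 1) # ys)) n)"
| "appr (Mu f) t xs =
    rec_nat 0
      (\<lambda>j s. if s = 0
         then if appr f t (j # xs) = 0 then 1
              else if appr f t (j # xs) - 1 = 0 then j + 2 else 0
         else s) t - 1"

section \<open>Bounded and unbounded search\<close>

text \<open>Think of \<open>a j\<close> as the bounded result at candidate \<open>j\<close>: 0 for
  no value, 1 for the value zero, more for a nonzero value. The state is 0 exactly while all
  candidates so far gave more than 1; the first other candidate freezes it.\<close>

lemma search_found_iff:
  fixes S a :: "nat \<Rightarrow> nat"
  assumes S0: "S 0 = 0"
    and step: "\<And>j. S (Suc j) = (if S j = 0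
      then if a j = 0 then 1 else if a j - 1 = 0 then j + 2 else 0 else S j)"
  shows "S t = Suc (Suc n) \<longleftrightarrow> n < t \<and> a n = 1 \<and> (\<forall>k<n. a k > 1)"
proof -
  have searching: "S t = 0 \<longleftrightarrow> (\<forall>k<t. a k > 1)" for t
    by (induction t) (auto simp: S0 step less_Suc_eq)
  show ?thesis
  proof (induction t)
    case 0
    show ?case by (simp add: S0)
  next
    case (Suc t)
    show ?case
    proof (cases "S t = 0")
      case True
      then have *: "\<forall>k<t. a k > 1" by (simp add: searching)
      then have "n < Suc t \<and> a n = 1 \<longleftrightarrow> n = t \<and> a t = 1"
        by (metis less_Suc_eq less_irrefl)
      moreover have "S (Suc t) = Suc (Suc n) \<longleftrightarrow> n = t \<and> a t = 1"
        using True by (auto simp: step)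
      ultimately show ?thesis using * by metis
    next
      case False
      then obtain k where "k < t" "\<not> a k > 1" by (auto simp: searching)
      then have "n < Suc t \<and> a n = 1 \<and> (\<forall>k<n. a k > 1) \<longleftrightarrow> n < t \<and> a n = 1 \<and> (\<forall>k<n. a k > 1)"
        using less_Suc_eq by metis
      moreover have "S (Suc t) = S t" using False by (simp add: step)
      ultimately show ?thesis using Suc.IH by simp
    qed
  qed
qed

lemma appr_Mu_iff:
  "appr (Mu f) t xs = Suc n \<longleftrightarrow>
    n < t \<and> appr f t (n # xs) = 1 \<and> (\<forall>k<n. appr f t (k # xs) > 1)"
proof -
  define S where "S = rec_nat 0
      (\<lambda>j s. if s = 0
         then if appr f t (j # xs) = 0 then 1
              else if appr f t (j # xs) - 1 = 0 then j + 2 else 0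
         else s)"
  have "S t = Suc (Suc n) \<longleftrightarrow>
      n < t \<and> appr f t (n # xs) = 1 \<and> (\<forall>k<n. appr f t (k # xs) > 1)"
    by (rule search_found_iff) (simp_all add: S_def)
  \<comment> \<open>The final subtraction sends both the searching state 0 and the stuck state 1 to
    0.\<close>
  moreover have "appr (Mu f) t xs = S t - 1" by (simp add: S_def)
  ultimately show ?thesis by auto
qed

text \<open>Brings \<open>LEAST\<close> into the shape of \<open>appr_Mu_iff\<close>, so that the
  \<open>Mu\<close> cases below reduce to the induction hypothesis at each candidate.\<close>

lemma run_Mu_iff:
  "run (Mu f) xs = Some n \<longleftrightarrow>
    run f (n # xs) = Some 0 \<and> (\<forall>k<n. \<exists>v. run f (k # xs) = Some (Suc v))" (is "?L \<longleftrightarrow> ?R")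
proof
  assume ?L
  then obtain m where m: "run f (m # xs) = Some 0" "\<forall>k<m. run f (k # xs) \<noteq> None"
    and n: "n = (LEAST n. run f (n # xs) = Some 0)"
    by (auto split: if_splits)
  have "run f (n # xs) = Some 0" unfolding n by (rule LeastI) (rule m)
  moreover have "n \<le> m" unfolding n by (rule Least_le) (rule m)
  moreover have "run f (k # xs) \<noteq> Some 0" if "k < n" for k
    using not_less_Least that unfolding n by blast
  ultimately show ?R
    using m(2) by (metis less_le_trans not0_implies_Suc option.exhaust)
next
  assume R: ?R
  then have "(LEAST n. run f (n # xs) = Some 0) = n"
    by (intro Least_equality) (force simp: not_less[symmetric])+
  moreover have "\<exists>n. run f (n # xs) = Some 0 \<and> (\<forall>k<n. run f (k # xs) \<noteq> None)"
    using R by (intro exI[of _ n]) auto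
  ultimately show ?L by simp
qed

section \<open>Soundness and completeness of the simulation\<close>

lemma appr_sound: "appr f t xs = Suc v \<Longrightarrow> run f xs = Some v"
proof (induction f arbitrary: xs v)
  case Succ
  then show ?case by (auto split: list.splits)
next
  case (Comp f gs)
  then have nz: "\<forall>g\<in>set gs. appr g t xs \<noteq> 0" by (auto split: if_splits)
  then have eq: "run g xs = Some (appr g t xs - 1)" if "g \<in> set gs" for g
    using Comp.IH(2) that by (metis diff_Suc_1 not0_implies_Suc)
  then show ?case
    using Comp.IH(1) Comp.prems nz by (auto cong: map_cong)
next
  case (PrimRec f g)
  then obtain n ys where xs: "xs = n # ys" by (cases xs) auto
  have "rec_nat (appr f t ys) (\<lambda>k r. if r = 0 then 0 else appr g t (k # (r - 1) # ys)) m = Suc v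
    \<Longrightarrow> rec_nat (run f ys) (\<lambda>k r. case r of None \<Rightarrow> None | Some v \<Rightarrow> run g (k # v # ys)) m = Some v"
    for m v
    using PrimRec.IH by (induction m arbitrary: v) (auto split: if_splits simp: gr0_conv_Suc)
  with PrimRec.prems xs show ?case by simp
next
  case (Mu f)
  then have "appr f t (v # xs) = Suc 0" "\<forall>k<v. \<exists>w. appr f t (k # xs) = Suc (Suc w)"
    unfolding appr_Mu_iff by (auto simp: gr0_conv_Suc less_iff_Suc_add)
  with Mu.IH show ?case unfolding run_Mu_iff by blast
qed (auto split: if_splits)

text \<open>Serves the finitely many arguments of a \<open>Comp\<close> and the finitely many
  rejected candidates of a \<open>Mu\<close>.\<close>

lemma common_bound:
  fixes Q :: "'a \<Rightarrow> nat \<Rightarrow> bool"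
  assumes "finite A" "\<And>x. x \<in> A \<Longrightarrow> \<exists>t. \<forall>t'\<ge>t. Q x t'"
  shows "\<exists>t. \<forall>x\<in>A. \<forall>t'\<ge>t. Q x t'"
  using assms
proof (induction A)
  case (insert a A)
  then obtain t u where "\<forall>x\<in>A. \<forall>t'\<ge>t. Q x t'" "\<forall>t'\<ge>u. Q a t'" by force
  then have "\<forall>x\<in>insert a A. \<forall>t'\<ge>max t u. Q x t'" by auto
  then show ?case by blast
qed simp

text \<open>Demanding the value for all \<open>t'\<close> beyond \<open>t\<close> makes the
  induction work: bounds found for subterms can be merged by \<open>max\<close>.\<close>

lemma appr_complete: "run f xs = Some v \<Longrightarrow> \<exists>t. \<forall>t'\<ge>t. appr f t' xs = Suc v"
proof (induction f arbitrary: xs v)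
  case Succ
  then show ?case by (auto split: list.splits)
next
  case (Comp f gs)
  then have nn: "\<forall>g\<in>set gs. run g xs \<noteq> None" by (auto split: if_splits)
  then have "\<exists>t. \<forall>g\<in>set gs. \<forall>t'\<ge>t. appr g t' xs = Suc (the (run g xs))"
    using Comp.IH(2) by (intro common_bound) auto
  then obtain t where t: "\<And>g t'. g \<in> set gs \<Longrightarrow> t' \<ge> t \<Longrightarrow> appr g t' xs = Suc (the (run g xs))"
    by blast
  have f: "run f (map (\<lambda>g. the (run g xs)) gs) = Some v"
    using Comp.prems by (auto split: if_splits)
  obtain u where u: "\<And>t'. t' \<ge> u \<Longrightarrow> appr f t' (map (\<lambda>g. the (run g xs)) gs) = Suc v"
    using Comp.IH(1) f by blast
  have "appr (Comp f gs) t' xs = Suc v" if "t' \<ge> max t u" for t'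
    using t u that by (auto cong: map_cong)
  then show ?case by blast
next
  case (PrimRec f g)
  then obtain n ys where xs: "xs = n # ys" by (cases xs) auto
  have "rec_nat (run f ys) (\<lambda>k r. case r of None \<Rightarrow> None | Some v \<Rightarrow> run g (k # v # ys)) m = Some v
    \<Longrightarrow> \<exists>t. \<forall>t'\<ge>t. rec_nat (appr f t' ys)
        (\<lambda>k r. if r = 0 then 0 else appr g t' (k # (r - 1) # ys)) m = Suc v"
    for m v
  proof (induction m arbitrary: v)
    case 0
    then show ?case using PrimRec.IH(1) by simp
  next
    case (Suc m)
    then obtain w where
      w: "rec_nat (run f ys) (\<lambda>k r. case r of None \<Rightarrow> None | Some v \<Rightarrow> run g (k # v # ys)) m = Some w"
        "run g (m # w # ys) = Some v"
      by (auto split: option.splits)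
    from Suc.IH[OF w(1)] PrimRec.IH(2)[OF w(2)] obtain t u where
      "\<forall>t'\<ge>t. rec_nat (appr f t' ys)
        (\<lambda>k r. if r = 0 then 0 else appr g t' (k # (r - 1) # ys)) m = Suc w"
      "\<forall>t'\<ge>u. appr g t' (m # w # ys) = Suc v"
      by blast
    then show ?case by (intro exI[of _ "max t u"]) auto
  qed
  with PrimRec.prems xs show ?case by simp
next
  case (Mu f)
  then have R: "run f (v # xs) = Some 0" "\<forall>k<v. \<exists>w. run f (k # xs) = Some (Suc w)"
    unfolding run_Mu_iff by auto
  obtain t where t: "\<forall>t'\<ge>t. appr f t' (v # xs) = 1"
    using Mu.IH[OF R(1)] by auto
  have "\<exists>u. \<forall>k\<in>{..<v}. \<forall>t'\<ge>u. appr f t' (k # xs) > 1"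
    by (rule common_bound) (use R(2) Mu.IH in \<open>fastforce+\<close>)
  then obtain u where "\<forall>k<v. \<forall>t'\<ge>u. appr f t' (k # xs) > 1" by auto
  \<comment> \<open>A search with bound \<open>t'\<close> tries only candidates below
    \<open>t'\<close>, hence the \<open>Suc v\<close>.\<close>
  with t show ?case
    unfolding appr_Mu_iff by (intro exI[of _ "max (Suc v) (max t u)"]) auto
qed auto

text \<open>The bound is an argument but the program \<open>f\<close> is fixed, so induction on
  \<open>f\<close> suffices. The arity \<open>k\<close> varies because subterms run on lists of
  other lengths.\<close>

lemma computable_appr: "computable (Suc k) (\<lambda>ys. appr f (hd ys) (tl ys))"
proof (induction f arbitrary: k)
  case Zero
  show ?case by (simp add: computable_const)
next
  case Succ
  show ?case
  proof (cases "k = 1")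
    case True
    have "computable (Suc k) (\<lambda>ys. Suc (Suc (ys ! 1)))"
      using True by (intro computable_Suc computable_nth) simp
    then show ?thesis
      by (rule computable_cong) (auto simp: True length_Suc_conv)
  next
    case False
    show ?thesis
      by (rule computable_cong[OF computable_const[of _ 0]])
        (use False in \<open>auto simp: length_Suc_conv split: list.split\<close>)
  qed
next
  case (Proj i)
  show ?case
  proof (cases "i < k")
    case True
    have "computable (Suc k) (\<lambda>ys. Suc (ys ! Suc i))"
      using True by (intro computable_Suc computable_nth) simp
    then show ?thesis
      by (rule computable_cong) (use True in \<open>auto simp: nth_tl\<close>)
  next
    case False
    show ?thesis
      by (rule computable_cong[OF computable_const[of _ 0]]) (use False in auto)
  qed
next
  case (Comp f gs)
  let ?a = "\<lambda>g ys. appr g (hd ys) (tl ys)"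
  have "computable (Suc k) (\<lambda>ys. (\<lambda>zs. appr f (hd zs) (tl zs))
      (map (\<lambda>g. g ys) ((\<lambda>ys. ys ! 0) # map (\<lambda>g ys. ?a g ys - 1) gs)))"
    using Comp.IH by (intro computable_map) (auto intro!: computable_nth computable_pred[unfolded One_nat_def])
  \<comment> \<open>The product vanishes iff some inner term has no value yet, which turns the
    bounded existential into arithmetic.\<close>
  moreover have "computable (Suc k) (\<lambda>ys. \<Prod>g\<leftarrow>gs. ?a g ys)"
    using Comp.IH(2) by (intro computable_prod_list)
  ultimately have "computable (Suc k) (\<lambda>ys. if (\<Prod>g\<leftarrow>gs. ?a g ys) = 0 then 0
      else (\<lambda>zs. appr f (hd zs) (tl zs)) (map (\<lambda>g. g ys) ((\<lambda>ys. ys ! 0) # map (\<lambda>g ys. ?a g ys - 1) gs)))"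
    by (intro computable_if computable_const)
  then show ?case
    by (rule computable_cong) (auto simp: prod_list_zero_iff comp_def length_Suc_conv)
next
  case (PrimRec f g)
  show ?case
  proof (cases k)
    case 0
    show ?thesis
      by (rule computable_cong[OF computable_const[of _ 0]]) (use 0 in \<open>auto simp: length_Suc_conv\<close>)
  next
    case (Suc l)
    have f: "computable (Suc k) (\<lambda>ys. (\<lambda>zs. appr f (hd zs) (tl zs))
        (map (\<lambda>g. g ys) ((\<lambda>ys. ys ! 0) # map (\<lambda>i ys. ys ! (i + 2)) [0..<l])))"
      using PrimRec.IH(1)[of l] Suc by (intro computable_map) (auto intro!: computable_nth)
    \<comment> \<open>Positions: 0 is the counter, 1 the previous result (shifted by one), 2 the
      step bound, 3 the recursion argument, and from 4 on the parameters.\<close>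
    have g: "computable (Suc (Suc (Suc k))) (\<lambda>ys. (\<lambda>zs. appr g (hd zs) (tl zs))
        (map (\<lambda>g. g ys) ((\<lambda>ys. ys ! 2) # (\<lambda>ys. ys ! 0) # (\<lambda>ys. ys ! 1 - 1)
          # map (\<lambda>i ys. ys ! (i + 4)) [0..<l])))"
      using PrimRec.IH(2)[of "Suc (Suc l)"] Suc
      by (intro computable_map) (auto intro!: computable_nth computable_pred[unfolded One_nat_def])
    have tail: "map (\<lambda>i. ys ! (i + m)) [0..<l] = drop m ys" if "length ys = l + m" for ys :: "nat list" and m
      by (rule nth_equalityI) (use that in \<open>auto simp: add.commute\<close>)
    let ?g = "\<lambda>ys j r. if r = 0 then 0 else appr g (hd ys) (j # (r - 1) # tl (tl ys))"
    have "computable (Suc (Suc (Suc k))) (\<lambda>ys. if ys ! 1 = 0 then 0 else (\<lambda>zs. appr g (hd zs) (tl zs))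
        (map (\<lambda>g. g ys) ((\<lambda>ys. ys ! 2) # (\<lambda>ys. ys ! 0) # (\<lambda>ys. ys ! 1 - 1)
          # map (\<lambda>i ys. ys ! (i + 4)) [0..<l])))"
      by (intro computable_if computable_const computable_nth g) simp
    then have "computable (Suc (Suc (Suc k))) (\<lambda>ys. ?g (tl (tl ys)) (ys ! 0) (ys ! 1))"
    proof (rule computable_cong)
      fix ys :: "nat list" assume len: "length ys = Suc (Suc (Suc k))"
      then obtain a b c d e where ys: "ys = a # b # c # d # e"
        using Suc by (auto simp: length_Suc_conv)
      then show "(if ys ! 1 = 0 then 0 else (\<lambda>zs. appr g (hd zs) (tl zs))
        (map (\<lambda>g. g ys) ((\<lambda>ys. ys ! 2) # (\<lambda>ys. ys ! 0) # (\<lambda>ys. ys ! 1 - 1)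
          # map (\<lambda>i ys. ys ! (i + 4)) [0..<l]))) = ?g (tl (tl ys)) (ys ! 0) (ys ! 1)"
        using tail[of ys 4] len Suc by (simp add: comp_def)
    qed
    then have "computable (Suc k) (\<lambda>ys. rec_nat ((\<lambda>zs. appr f (hd zs) (tl zs))
        (map (\<lambda>g. g ys) ((\<lambda>ys. ys ! 0) # map (\<lambda>i ys. ys ! (i + 2)) [0..<l]))) (?g ys) (ys ! 1))"
      using Suc by (intro computable_rec_nat f computable_nth) simp_all
    then show ?thesis
    proof (rule computable_cong)
      fix ys :: "nat list" assume len: "length ys = Suc k"
      then obtain a b c where ys: "ys = a # b # c"
        using Suc by (auto simp: length_Suc_conv)
      then show "rec_nat ((\<lambda>zs. appr f (hd zs) (tl zs))
        (map (\<lambda>g. g ys) ((\<lambda>ys. ys ! 0) # map (\<lambda>i ys. ys ! (i + 2)) [0..<l]))) (?g ys) (ys ! 1)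
        = appr (PrimRec f g) (hd ys) (tl ys)"
        using tail[of ys 2] len Suc by (simp add: comp_def cong: if_cong)
    qed
  qed
next
  case (Mu f)
  let ?g = "\<lambda>ys j s. if s = 0
         then if appr f (hd ys) (j # tl ys) = 0 then 1
              else if appr f (hd ys) (j # tl ys) - 1 = 0 then j + 2 else 0
         else s"
  \<comment> \<open>Positions: 0 is the candidate, 1 the search state, 2 the step bound, and from 3
    on the arguments.\<close>
  have "computable (Suc (Suc (Suc k))) (\<lambda>ys. (\<lambda>zs. appr f (hd zs) (tl zs))
      (map (\<lambda>g. g ys) ((\<lambda>ys. ys ! 2) # (\<lambda>ys. ys ! 0) # map (\<lambda>i ys. ys ! (i + 3)) [0..<k])))"
    using Mu.IH[of "Suc k"] by (intro computable_map) (auto intro!: computable_nth)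
  then have f: "computable (Suc (Suc (Suc k)))
      (\<lambda>ys. appr f (hd (tl (tl ys))) (ys ! 0 # tl (tl (tl ys))))"
  proof (rule computable_cong)
    fix ys :: "nat list" assume "length ys = Suc (Suc (Suc k))"
    then obtain a b c d where "ys = a # b # c # d" "length d = k"
      by (auto simp: length_Suc_conv)
    moreover from this have "map ((!) d) [0..<k] = d"
      using map_nth[of d] by simp
    ultimately show "(\<lambda>zs. appr f (hd zs) (tl zs))
      (map (\<lambda>g. g ys) ((\<lambda>ys. ys ! 2) # (\<lambda>ys. ys ! 0) # map (\<lambda>i ys. ys ! (i + 3)) [0..<k]))
      = appr f (hd (tl (tl ys))) (ys ! 0 # tl (tl (tl ys)))"
      by (simp add: comp_def)
  qed
  have "computable (Suc k) (\<lambda>ys. rec_nat 0 (?g ys) (ys ! 0) - 1)"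
    by (intro computable_pred computable_rec_nat computable_if computable_const computable_nth
        computable_add f) simp_all
  then show ?case
    by (rule computable_cong) (auto simp: length_Suc_conv)
qed


section \<open>The diagonal problem\<close>

lemma crn_val_eqI: "run (fst x) [n] = Some (rat_code q) \<Longrightarrow> crn_val x n = q"
  unfolding crn_val_def by (auto intro: the_equality dest: rat_code_inject)

text \<open>The fraction is already in lowest terms and \<open>int_encode 1 = 2\<close>, so a
  program can output such a rational by pairing alone.\<close>

lemma rat_code_inverse_Suc: "rat_code (1 / of_nat (Suc n)) = prod_encode (2, Suc n)"
proof -
  have "(1 / of_nat (Suc n) :: rat) = Fract 1 (int (Suc n))"
    by (simp add: Fract_of_int_quotient)
  then have "quotient_of (1 / of_nat (Suc n)) = (1, int (Suc n))"
    by (simp only:) (simp add: quotient_of_Fract)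
  then show ?thesis
    by (simp add: rat_code_def int_encode_def sum_encode_def del: of_nat_Suc)
qed

text \<open>A positive rational is at least the inverse of its denominator, and the denominator is
  at most the code. Hence the code of \<epsilon> can itself serve as a modulus, computed by
  \<open>Proj 0\<close>.\<close>

lemma rat_code_ge_inverse:
  assumes "\<epsilon> > 0"
  shows "of_nat (rat_code \<epsilon>) * \<epsilon> \<ge> 1"
proof -
  obtain a b where ab: "quotient_of \<epsilon> = (a, b)" by fastforce
  then have b: "b > 0" and \<epsilon>: "\<epsilon> = of_int a / of_int b"
    by (auto intro: quotient_of_denom_pos quotient_of_div)
  with assms have a: "a \<ge> 1" by (auto simp: zero_less_divide_iff)
  have "nat b \<le> rat_code \<epsilon>"
    using ab by (simp add: rat_code_def le_prod_encode_2)
  then have "b \<le> int (rat_code \<epsilon>)" by simp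
  then have "b * 1 \<le> int (rat_code \<epsilon>) * a"
    using a b by (intro mult_mono) auto
  then have "(of_int b :: rat) \<le> of_int (int (rat_code \<epsilon>) * a)"
    by (intro of_int_le_iff[THEN iffD2]) simp
  with b show ?thesis by (simp add: \<epsilon> field_simps)
qed

definition rat_crn :: "rat \<Rightarrow> crn" where
  "rat_crn q = (numeral_recf (rat_code q), Zero)"

lemma crn_val_rat_crn [simp]: "crn_val (rat_crn q) n = q"
  by (rule crn_val_eqI) (simp add: rat_crn_def)

lemma is_crn_rat_crn [simp]: "is_crn (rat_crn q)"
  unfolding is_crn_def crn_val_rat_crn by (auto simp: rat_crn_def)

lemma creal_leI_eventually:
  assumes "\<And>m n. m > M \<Longrightarrow> n > M \<Longrightarrow> x n \<le> y m"
  shows "creal_le x y"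
  unfolding creal_le_def
proof (intro exI[of _ "numeral_recf M"] allI impI exI[of _ M] conjI)
  fix \<epsilon> :: rat and m n assume "\<epsilon> > 0" "m > M" "n > M"
  then show "y m > x n - \<epsilon>" using assms[of m n] by simp
qed simp

lemma creal_leI: "(\<And>m n. x n \<le> y m) \<Longrightarrow> creal_le x y"
  by (rule creal_leI_eventually)

lemma crn_val_bounded:
  assumes "is_crn x"
  shows "\<exists>B::nat. \<forall>n. \<bar>crn_val x n\<bar> \<le> of_nat B"
proof -
  obtain N where N: "\<And>m n. m > N \<Longrightarrow> n > N \<Longrightarrow> \<bar>crn_val x m - crn_val x n\<bar> < 1"
    using assms unfolding is_crn_def by (metis zero_less_one)
  \<comment> \<open>The sum dominates every term up to \<open>Suc N\<close>, the first index covered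
    by the Cauchy condition; the added 1 covers the tail.\<close>
  define C where "C = (\<Sum>i\<le>Suc N. \<bar>crn_val x i\<bar>) + 1"
  have le: "\<bar>crn_val x i\<bar> \<le> (\<Sum>i\<le>Suc N. \<bar>crn_val x i\<bar>)" if "i \<le> Suc N" for i
    by (rule member_le_sum) (use that in auto)
  have "\<bar>crn_val x n\<bar> \<le> C" for n
  proof (cases "n \<le> Suc N")
    case True
    then show ?thesis using le[of n] by (simp add: C_def)
  next
    case False
    then have "\<bar>crn_val x n - crn_val x (Suc N)\<bar> < 1" by (intro N) auto
    then show ?thesis
      using le[OF order_refl] unfolding C_def by linarith
  qed
  moreover obtain B :: nat where "C \<le> of_nat B" using real_arch_simple by blast
  ultimately show ?thesis by (meson order_trans)
qed

section \<open>The problem on the unit interval\<close>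

definition interval_constraints :: "lin_constraint list" where
  "interval_constraints = [([rat_crn 1], AtLeast, rat_crn 0), ([rat_crn 1], AtMost, rat_crn 1)]"

definition unit_problem :: "crn \<Rightarrow> clpp" where
  "unit_problem a = CLPP Maximize [a] interval_constraints"

lemma lin_val_single [simp]: "lin_val [a] [x] n = crn_val a n * crn_val x n"
  by (simp add: lin_val_def)

lemma is_clpp_unit_problem: "is_crn a \<Longrightarrow> is_clpp (unit_problem a)"
  by (auto simp: is_clpp_def unit_problem_def interval_constraints_def)

lemma allowable_unit_problem_iff:
  "allowable (unit_problem a) p \<longleftrightarrow>
    (\<exists>x. p = [x] \<and> is_crn x \<and> creal_le (\<lambda>_. 0) (crn_val x) \<and> creal_le (crn_val x) (\<lambda>_. 1))"
proof -
  have *: "lin_val [rat_crn 1] [x] = crn_val x" "crn_val (rat_crn q) = (\<lambda>_. q)" for x q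
    by auto
  show ?thesis
    by (auto simp: allowable_def is_plan_def unit_problem_def interval_constraints_def
        length_Suc_conv * cong: conj_cong)
qed

lemma allowable_rat_crn:
  "0 \<le> q \<Longrightarrow> q \<le> 1 \<Longrightarrow> allowable (unit_problem a) [rat_crn q]"
  by (auto simp: allowable_unit_problem_iff intro!: creal_leI)

lemma plans_bounded_unit_problem: "plans_bounded (unit_problem a)"
  unfolding plans_bounded_def
\<comment> \<open>Each constraint is used only at \<epsilon> = 1, giving -1 < x < 2 from a fixed
  index on. The bound 2 then needs only a constant algorithm.\<close>
proof (intro exI[of _ 2] allI impI ballI)
  fix p x assume "allowable (unit_problem a) p" "x \<in> set p"
  then have le: "creal_le (\<lambda>_. 0) (crn_val x)" "creal_le (crn_val x) (\<lambda>_. 1)"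
    by (auto simp: allowable_unit_problem_iff)
  obtain M where M: "\<And>m. m > M \<Longrightarrow> crn_val x m > 0 - 1"
    using le(1) unfolding creal_le_def by (metis zero_less_one)
  obtain N where N: "\<And>n. n > N \<Longrightarrow> 1 > crn_val x n - 1"
    using le(2) unfolding creal_le_def by (metis zero_less_one)
  show "creal_le (\<lambda>n. \<bar>crn_val x n\<bar>) (\<lambda>_. 2)"
  proof (rule creal_leI_eventually[where M = "max M N"])
    fix n assume "max M N < n"
    then show "\<bar>crn_val x n\<bar> \<le> 2" using M[of n] N[of n] by simp
  qed
qed

lemma optimal_zero_iff:
  "optimal (unit_problem a) [rat_crn 0] \<longleftrightarrow>
    (\<forall>x. allowable (unit_problem a) [x] \<longrightarrow> creal_le (\<lambda>n. crn_val a n * crn_val x n) (\<lambda>_. 0))"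
proof -
  have *: "lin_val [a] [x] = (\<lambda>n. crn_val a n * crn_val x n)"
    "lin_val [a] [rat_crn 0] = (\<lambda>_. 0)" for x
    by auto
  have "allowable (unit_problem a) q \<Longrightarrow> \<exists>x. q = [x]" for q
    by (auto simp: allowable_unit_problem_iff)
  then show ?thesis
    unfolding optimal_def
    using allowable_rat_crn[of 0 a] * by (fastforce simp: unit_problem_def)
qed

section \<open>Programs and self-referential coding\<close>

lemma computable_unary_recf:
  assumes "computable 1 \<phi>"
  shows "\<exists>f. \<forall>x. run f [x] = Some (\<phi> [x])"
  using assms unfolding computable_def by (metis One_nat_def length_Cons list.size(3))

text \<open>\<open>S\<close> receives its own code as a hard-wired numeral, which takes the place of
  the recursion theorem.\<close>

definition diag_crn :: "recf \<Rightarrow> crn" where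
  "diag_crn S = (Comp S [numeral_recf (recf_code S), Proj 0], Proj 0)"

definition problem_input :: "crn \<Rightarrow> nat" where
  "problem_input a = prod_encode (clpp_code (unit_problem a), crns_code [rat_crn 0])"

text \<open>\<open>problem_input (diag_crn S)\<close> with the encoders unfolded around the code
  \<open>s\<close> of \<open>S\<close>, so that it is visibly arithmetic in
  \<open>s\<close>.\<close>

definition diag_input :: "nat \<Rightarrow> nat" where
  "diag_input s = prod_encode (prod_encode (0, prod_encode (
      Suc (prod_encode (prod_encode (
        prod_encode (3, prod_encode (s,
          Suc (prod_encode (recf_code (numeral_recf s), list_encode [recf_code (Proj 0)])))),
        recf_code (Proj 0)), 0)),
      list_encode (map constraint_code interval_constraints))), crns_code [rat_crn 0])"

lemma problem_input_diag_crn: "problem_input (diag_crn S) = diag_input (recf_code S)"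
  by (simp add: problem_input_def clpp_code_def unit_problem_def crns_code_def crn_code_def
      diag_crn_def diag_input_def)

lemma computable_diag_input: "computable k f \<Longrightarrow> computable k (\<lambda>xs. diag_input (f xs))"
  unfolding diag_input_def
  by (intro computable_prod_encode computable_Suc computable_const computable_numeral_code)

section \<open>The stopping counter\<close>

context
  fixes C :: "nat \<Rightarrow> bool"
begin

text \<open>This is the minimum of \<open>n\<close> and the least \<open>k\<close> with
  \<open>C k\<close>, or \<open>n\<close> if there is no such \<open>k\<close>.\<close>

primrec counter :: "nat \<Rightarrow> nat" where
  "counter 0 = 0"
| "counter (Suc n) = (if C (counter n) then counter n else Suc (counter n))"

lemma counter_stays: "counter n < n \<Longrightarrow> C (counter n)"
  by (induction n) (auto split: if_splits)

lemma counter_upper: "C k \<Longrightarrow> counter n \<le> k"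
  by (induction n) (auto simp: le_less Suc_le_eq)

lemma counter_unstopped: "(\<And>k. \<not> C k) \<Longrightarrow> counter n = n"
  by (induction n) auto

text \<open>The modulus does not depend on whether the counter ever stops: either it stops at some
  value up to \<open>N\<close> and both terms agree, or both terms lie strictly between 0 and
  1/(N+1).\<close>

lemma counter_inverse_Cauchy:
  assumes "m > N" "n > N"
  shows "\<bar>1 / of_nat (Suc (counter m)) - 1 / of_nat (Suc (counter n)) :: rat\<bar> < 1 / of_nat (Suc N)"
proof -
  have *: "counter n = counter m" if "m > N" "n > N" "counter m \<le> N" for m n
  proof -
    have C: "C (counter m)" using counter_stays that by simp
    then have "counter n \<le> counter m" by (rule counter_upper)
    with that have "C (counter n)" using counter_stays by simp
    then have "counter m \<le> counter n" by (rule counter_upper)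
    with \<open>counter n \<le> counter m\<close> show ?thesis by simp
  qed
  show ?thesis
  proof (cases "counter m \<le> N \<or> counter n \<le> N")
    case True
    then have "counter m = counter n" using * assms by metis
    then show ?thesis by simp
  next
    case False
    then have "(0::rat) < 1 / of_nat (Suc (counter m))" "(0::rat) < 1 / of_nat (Suc (counter n))"
      "(1::rat) / of_nat (Suc (counter m)) < 1 / of_nat (Suc N)"
      "(1::rat) / of_nat (Suc (counter n)) < 1 / of_nat (Suc N)"
      by (simp_all add: field_simps)
    then show ?thesis by linarith
  qed
qed

end

lemma diag_crn_exists:
  obtains a where
    "\<And>n. run (fst a) [n] =
      Some (rat_code (1 / of_nat (Suc (counter (\<lambda>t. appr D t [problem_input a] > 1) n))))"
    and "snd a = Proj 0"
proof -
  \<comment> \<open>The counter value \<open>r\<close> is itself the step bound. The test succeeds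
    while no nonzero answer of \<open>D\<close> is visible.\<close>
  let ?step = "\<lambda>xs _ r. if appr D r [diag_input (xs ! 0)] - 1 = 0 then Suc r else r"
  have "computable 4 (\<lambda>ys. (\<lambda>zs. appr D (hd zs) (tl zs))
      (map (\<lambda>g. g ys) [\<lambda>ys. ys ! 1, \<lambda>ys. diag_input (ys ! 2)]))"
    using computable_appr[of 1 D]
    by (intro computable_map) (auto simp: numeral_2_eq_2 intro!: computable_nth computable_diag_input)
  then have "computable (Suc (Suc 2)) (\<lambda>ys. appr D (ys ! 1) [diag_input (tl (tl ys) ! 0)])"
    by (simp add: numeral_eq_Suc) (erule computable_cong, auto simp: length_Suc_conv)
  then have "computable 2 (\<lambda>xs. prod_encode (2, Suc (rec_nat 0 (?step xs) (xs ! 1))))"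
    by (intro computable_prod_encode computable_Suc computable_rec_nat computable_if computable_pred
        computable_const computable_nth) simp_all
  then obtain S where
    S: "\<And>xs. length xs = 2 \<Longrightarrow> run S xs = Some (prod_encode (2, Suc (rec_nat 0 (?step xs) (xs ! 1))))"
    unfolding computable_def by blast
  have rec: "rec_nat 0 (?step [s, n]) m = counter (\<lambda>t. appr D t [diag_input s] > 1) m" for s n m
    by (induction m) auto
  \<comment> \<open>Feeding \<open>S\<close> its own code closes the loop: \<open>D\<close> is
    simulated on the very problem whose coefficient is being computed.\<close>
  have "run (fst (diag_crn S)) [n] = Some (rat_code (1 / of_nat
      (Suc (counter (\<lambda>t. appr D t [problem_input (diag_crn S)] > 1) n))))" for n
    using S[of "[recf_code S, n]"] rec[of "recf_code S" n n]
    by (simp add: diag_crn_def[of S] problem_input_diag_crn[unfolded diag_crn_def] rat_code_inverse_Suc del: of_nat_Suc)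
  then show thesis
    by (intro that[of "diag_crn S"]) (auto simp: diag_crn_def)
qed

section \<open>Null and positive coefficients, and the contradiction\<close>

lemma optimal_zero_if_null:
  assumes a: "\<And>n. crn_val a n = 1 / of_nat (Suc n)"
  shows "optimal (unit_problem a) [rat_crn 0]"
  unfolding optimal_zero_iff
proof (intro allI impI)
  fix x assume "allowable (unit_problem a) [x]"
  then have "is_crn x" by (auto simp: allowable_unit_problem_iff)
  then obtain B :: nat where B: "\<And>n. \<bar>crn_val x n\<bar> \<le> of_nat B"
    using crn_val_bounded by blast
  \<comment> \<open>The cost at index n is at most B/(n+1), which is below \<epsilon> once n exceeds
    B times the code of \<epsilon>.\<close>
  have "computable 1 (\<lambda>xs. B * xs ! 0)"
    by (intro computable_mult computable_const computable_nth) simp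
  then obtain A where A: "\<And>e. run A [e] = Some (B * e)"
    using computable_unary_recf by fastforce
  show "creal_le (\<lambda>n. crn_val a n * crn_val x n) (\<lambda>_. 0)"
    unfolding creal_le_def
  proof (intro exI[of _ A] allI impI)
    fix \<epsilon> :: rat assume \<epsilon>: "\<epsilon> > 0"
    have "0 > crn_val a n * crn_val x n - \<epsilon>" if n: "n > B * rat_code \<epsilon>" for n
    proof -
      have "of_nat B * 1 \<le> of_nat B * (of_nat (rat_code \<epsilon>) * \<epsilon>)"
        using rat_code_ge_inverse[OF \<epsilon>] by (intro mult_left_mono) auto
      also have "\<dots> = of_nat (B * rat_code \<epsilon>) * \<epsilon>" by simp
      also have "\<dots> < of_nat (Suc n) * \<epsilon>"
        using n \<epsilon> by (intro mult_strict_right_mono) (auto simp only: of_nat_less_iff less_Suc_eq)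
      finally have "of_nat B < of_nat (Suc n) * \<epsilon>" by simp
      moreover have "crn_val x n \<le> of_nat B" using B[of n] by simp
      ultimately have "crn_val x n < of_nat (Suc n) * \<epsilon>" by simp
      then show ?thesis by (simp add: a field_simps)
    qed
    with A show "\<exists>M. run A [rat_code \<epsilon>] = Some M \<and>
        (\<forall>m n. m > M \<longrightarrow> n > M \<longrightarrow> 0 > crn_val a n * crn_val x n - \<epsilon>)"
      by blast
  qed
qed

lemma not_optimal_zero_if_pos:
  assumes "\<delta> > 0" and a: "\<And>n. crn_val a n \<ge> \<delta>"
  shows "\<not> optimal (unit_problem a) [rat_crn 0]"
proof
  assume "optimal (unit_problem a) [rat_crn 0]"
  \<comment> \<open>The competing plan is 1, whose cost is \<open>a\<close> itself.\<close>
  then have "creal_le (\<lambda>n. crn_val a n * crn_val (rat_crn 1) n) (\<lambda>_. 0)"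
    using allowable_rat_crn[of 1 a] by (simp only: optimal_zero_iff zero_le_one order_refl)
  then have "creal_le (crn_val a) (\<lambda>_. 0)" by simp
  then obtain M where "\<And>n. n > M \<Longrightarrow> 0 > crn_val a n - \<delta>"
    using assms(1) unfolding creal_le_def by metis
  from this[of "Suc M"] a[of "Suc M"] show False by simp
qed

theorem theorem5: "\<not> (\<exists>D. decides_optimality D)"
proof
  assume "\<exists>D. decides_optimality D"
  then obtain D where D: "decides_optimality D" ..
  obtain a where run_a: "\<And>n. run (fst a) [n] =
      Some (rat_code (1 / of_nat (Suc (counter (\<lambda>t. appr D t [problem_input a] > 1) n))))"
    and modulus: "snd a = Proj 0"
    using diag_crn_exists[of D] by blast
  define h where "h = counter (\<lambda>t. appr D t [problem_input a] > 1)"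
  have a: "crn_val a n = 1 / of_nat (Suc (h n))" for n
    using crn_val_eqI[OF run_a] by (simp add: h_def)
  have "is_crn a"
    unfolding is_crn_def
  proof (intro conjI allI impI)
    fix \<epsilon> :: rat assume \<epsilon>: "\<epsilon> > 0"
    let ?N = "rat_code \<epsilon>"
    have "1 \<le> of_nat ?N * \<epsilon>" using rat_code_ge_inverse[OF \<epsilon>] .
    also have "\<dots> \<le> of_nat (Suc ?N) * \<epsilon>" using \<epsilon> by (intro mult_right_mono) auto
    finally have "1 / of_nat (Suc ?N) \<le> \<epsilon>" by (simp add: field_simps)
    then have "\<bar>crn_val a m - crn_val a n\<bar> < \<epsilon>" if "m > ?N" "n > ?N" for m n
      using counter_inverse_Cauchy[OF that] unfolding a h_def by (rule less_le_trans[rotated])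
    then show "\<exists>N. run (snd a) [rat_code \<epsilon>] = Some N \<and>
        (\<forall>m n. m > N \<longrightarrow> n > N \<longrightarrow> \<bar>crn_val a m - crn_val a n\<bar> < \<epsilon>)"
      by (auto simp: modulus)
  qed (use run_a in blast)
  moreover have allow: "allowable (unit_problem a) [rat_crn 0]"
    by (rule allowable_rat_crn) auto
  ultimately have run_D: "run D [problem_input a] =
      Some (if optimal (unit_problem a) [rat_crn 0] then 1 else 0)"
    using D is_clpp_unit_problem plans_bounded_unit_problem
    unfolding decides_optimality_def plans_nonempty_def problem_input_def by blast
  show False
  proof (cases "optimal (unit_problem a) [rat_crn 0]")
    case True
    \<comment> \<open>The answer 1 appears as 2 in \<open>appr\<close>; the counter can never pass a
      bound \<open>t\<close> at which it is visible.\<close>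
    then obtain t where "appr D t [problem_input a] = Suc 1"
      using appr_complete[OF run_D] by auto
    then have "appr D t [problem_input a] > 1" by simp
    then have "h n \<le> t" for n
      unfolding h_def by (rule counter_upper)
    then have "crn_val a n \<ge> 1 / of_nat (Suc t)" for n
      by (simp add: a frac_le)
    then have "\<not> optimal (unit_problem a) [rat_crn 0]"
      by (intro not_optimal_zero_if_pos[where \<delta> = "1 / of_nat (Suc t)"]) auto
    with True show False by blast
  next
    case False
    \<comment> \<open>The answer 0 appears as 1 in \<open>appr\<close>, so the stopping test never
      fires.\<close>
    have "\<not> appr D t [problem_input a] > 1" for t
    proof
      assume "appr D t [problem_input a] > 1"
      then obtain v where "appr D t [problem_input a] = Suc (Suc v)"
        by (auto simp: less_iff_Suc_add)
      with appr_sound run_D False show False by fastforce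
    qed
    then have "h n = n" for n
      unfolding h_def by (rule counter_unstopped)
    with a have "optimal (unit_problem a) [rat_crn 0]"
      by (intro optimal_zero_if_null) simp
    with False show False by blast
  qed
qed

end
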